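(* Let $k\ge 2$ be an integer, let $A$ be a unital $C^*$-algebra, and let $\alpha$ be a free action of $\mathbb{Z}/k\mathbb{Z}$ on $A$. Suppose $\phi_1: A\to A$ is an $\alpha$-equivariant unital $*$-homomorphism, i.e. $\phi_1\circ\alpha_g=\alpha_g\circ\phi_1$ for all $g\in\mathbb{Z}/k\mathbb{Z}$. Then there does not exist a family $(\phi_t)_{t\in[0,1]}$ of unital $*$-homomorphisms $\phi_t:A\to A$ such that $t\mapsto \phi_t(a)$ is norm-continuous for every $a\in A$, $\phi_1$ is the given map, and $\phi_0$ is a one-dimensional representation, i.e. $\phi_0(A)\subseteq \mathbb{C}1_A$ (so $\phi_0$ is a unital $*$-homomorphism $A\to\mathbb{C}$).
   Context: An action of $\mathbb{Z}/k\mathbb{Z}$ on a unital $C^*$-algebra $A$ is a group homomorphism $g\mapsto\alpha_g$ into $\mathrm{Aut}(A)$; it is determined by the automorphism $\alpha=\alpha_1$ with $\alpha^k=\mathrm{id}$. The action is called free if the associated coaction $\delta:A\to A\otimes C(\mathbb{Z}/k\mathbb{Z})\cong C(\mathbb{Z}/k\mathbb{Z},A)$, $\delta(a)(g)=\alpha_g(a)$, satisfies the Ellwood condition: the closed linear span of $\{(a\otimes 1)\delta(b): a,b\in A\}$ equals $A\otimes C(\mathbb{Z}/k\mathbb{Z})$. Equivalently, the action is saturated: for every $k$th root of unity $\lambda$, the spectral subspace $A_\lambda=\{a\in A:\alpha(a)=\lambda a\}$ satisfies $A=\overline{\mathrm{span}}\,(A_\lambda^*AA_\lambda)$; equivalently,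 the $\mathbb{Z}/k\mathbb{Z}$-grading $A=\bigoplus_m A_m$ by spectral subspaces is strong, $A_mA_n=A_{m+n}$ for all $m,n$. *)

theory Defs
  imports "HOL-Analysis.Analysis"
begin

text \<open>Unital C*-algebras, rendered as a type class.  The underlying real Banach algebra
  structure (with norm 1 = 1, so the algebra is nonzero) comes from the library; we add a
  complex scalar multiplication compatible with the real one, and an involution satisfying
  the C*-identity.\<close>

class cstar_algebra_1 = real_normed_algebra_1 + banach +
  fixes scaleC :: "complex \<Rightarrow> 'a \<Rightarrow> 'a"
    and invol :: "'a \<Rightarrow> 'a"
  assumes scaleC_of_real: "scaleC (complex_of_real r) x = scaleR r x"
    and scaleC_add_left: "scaleC (c + d) x = scaleC c x + scaleC d x"
    and scaleC_add_right: "scaleC c (x + y) = scaleC c x + scaleC c y"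
    and scaleC_scaleC: "scaleC c (scaleC d x) = scaleC (c * d) x"
    and scaleC_mult_left: "scaleC c x * y = scaleC c (x * y)"
    and scaleC_mult_right: "x * scaleC c y = scaleC c (x * y)"
    and norm_scaleC: "norm (scaleC c x) = cmod c * norm x"
    and invol_invol: "invol (invol x) = x"
    and invol_add: "invol (x + y) = invol x + invol y"
    and invol_scaleC: "invol (scaleC c x) = scaleC (cnj c) (invol x)"
    and invol_mult: "invol (x * y) = invol y * invol x"
    and cstar_identity: "norm (invol x * x) = norm x ^ 2"

definition unital_star_hom :: "('a::cstar_algebra_1 \<Rightarrow> 'a) \<Rightarrow> bool" where
  "unital_star_hom f \<longleftrightarrow>
     (\<forall>x y. f (x + y) = f x + f y) \<and>
     (\<forall>c x. f (scaleC c x) = scaleC c (f x)) \<and>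
     (\<forall>x y. f (x * y) = f x * f y) \<and>
     (\<forall>x. f (invol x) = invol (f x)) \<and>
     f 1 = 1"

text \<open>An action of Z/kZ on A: a *-automorphism \<alpha> with \<alpha>^k = id; the action is
  g \<mapsto> \<alpha>^g (g = 0,...,k-1).\<close>

definition zk_action :: "nat \<Rightarrow> ('a::cstar_algebra_1 \<Rightarrow> 'a) \<Rightarrow> bool" where
  "zk_action k \<alpha> \<longleftrightarrow> unital_star_hom \<alpha> \<and> bij \<alpha> \<and> (\<alpha> ^^ k) = id"

text \<open>Freeness (Ellwood condition).  We identify A \<otimes> C(Z/kZ) with C(Z/kZ, A), i.e. with
  functions on {0..<k} with the sup norm; the element (a \<otimes> 1)\<delta>(b) is g \<mapsto> a \<alpha>^g(b).
  Since scalars can be absorbed into a, the linear span consists of finite sums of such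
  elements, and the condition says this span is dense in C(Z/kZ, A) (the inclusion of the
  closed span in A \<otimes> C(Z/kZ) is automatic).\<close>

definition free_zk_action :: "nat \<Rightarrow> ('a::cstar_algebra_1 \<Rightarrow> 'a) \<Rightarrow> bool" where
  "free_zk_action k \<alpha> \<longleftrightarrow> zk_action k \<alpha> \<and>
     (\<forall>f :: nat \<Rightarrow> 'a. \<forall>\<epsilon>>0. \<exists>n (a :: nat \<Rightarrow> 'a) (b :: nat \<Rightarrow> 'a).
        \<forall>g<k. norm (f g - (\<Sum>i<n. a i * (\<alpha> ^^ g) (b i))) < \<epsilon>)"

end

theory Submission
  imports Defs "HOL-Number_Theory.Cong" "HOL-Library.Real_Mod"
begin

text \<open>
  The characters of \<open>A\<close> form a free \<open>\<int>/k\<close>-space on which precomposition with \<open>\<phi>\<^sub>1\<close> is an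
  equivariant self-map \<open>f\<close>, and \<open>\<phi>\<^sub>t\<close> deforms \<open>f\<close> to a constant map. If \<open>h\<close> is the induced chain
  homotopy, \<open>T\<close> the generator and \<open>N\<close> the norm element of the group ring, then \<open>c\<^sub>0 = [x\<^sub>0]\<close>,
  \<open>c\<^sub>2\<^sub>m\<^sub>+\<^sub>1 = h (T - 1) c\<^sub>2\<^sub>m\<close>, \<open>c\<^sub>2\<^sub>m\<^sub>+\<^sub>2 = h N c\<^sub>2\<^sub>m\<^sub>+\<^sub>1\<close> satisfy \<open>\<partial>c\<^sub>2\<^sub>m\<^sub>+\<^sub>1 = (T - 1) f c\<^sub>2\<^sub>m\<close> and
  \<open>\<partial>c\<^sub>2\<^sub>m\<^sub>+\<^sub>2 = N f c\<^sub>2\<^sub>m\<^sub>+\<^sub>1\<close>. They imitate the periodic resolution of \<open>\<int>/k\<close>, so a product of \<open>m\<close>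
  invariant 2-cocycles representing the generator of the second cohomology group of \<open>\<int>/k\<close> takes the
  value \<open>(-1)\<^sup>m\<close> modulo \<open>k\<close> on \<open>c\<^sub>2\<^sub>m\<close>. Freeness yields finitely many eigenfunctions \<open>\<beta>\<^sub>1, \<dots>, \<beta>\<^sub>n\<close> for
  the eigenvalue \<open>e\<^bsup>2\<pi>i/k\<^esup>\<close> without common zeros. The phase of \<open>\<beta>\<^sub>i\<close> defines such a cocycle which
  vanishes on small simplices where \<open>\<beta>\<^sub>i\<close> is nonzero. Hence the product of all \<open>n\<close> cocycles
  vanishes on small simplices, contradicting its value on \<open>c\<^sub>2\<^sub>n\<close>. The homotopy is only
  discretised in time, so that Vietoris chains suffice and no subdivision of simplices is needed.
\<close>

section \<open>Cochains on lists\<close>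

text \<open>An ordered \<open>q\<close>-simplex is a list of \<open>q + 1\<close> points; a cochain is evaluated on lists of all
  lengths, and the empty list makes the complex augmented.\<close>

fun cobd :: "('x list \<Rightarrow> int) \<Rightarrow> 'x list \<Rightarrow> int" where
  "cobd F [] = 0"
| "cobd F (x # xs) = F xs - cobd (\<lambda>l. F (x # l)) xs"

text \<open>The classical prism operator in dual form: \<open>F\<close> is summed, with alternating
  signs, over the simplices \<open>a x_0, ..., a x_i, b x_i, ..., b x_q\<close>.\<close>

fun prism :: "('x \<Rightarrow> 'y) \<Rightarrow> ('x \<Rightarrow> 'y) \<Rightarrow> ('y list \<Rightarrow> int) \<Rightarrow> 'x list \<Rightarrow> int" where
  "prism a b F [] = 0"
| "prism a b F (x # xs) = F (a x # b x # map b xs) - prism a b (\<lambda>l. F (a x # l)) xs"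

lemma cobd_add: "cobd (\<lambda>l. F l + G l) xs = cobd F xs + cobd G xs"
  by (induction xs arbitrary: F G) auto

lemma cobd_diff: "cobd (\<lambda>l. F l - G l) xs = cobd F xs - cobd G xs"
  by (induction xs arbitrary: F G) auto

lemma cobd_mult: "cobd (\<lambda>l. c * F l) xs = c * cobd F xs"
  by (induction xs arbitrary: F) (auto simp: right_diff_distrib)

lemma cobd_zero: "cobd (\<lambda>l. 0) xs = 0"
  by (induction xs) auto

lemma cobd_sum: "cobd (\<lambda>l. \<Sum>i\<in>I. F i l) xs = (\<Sum>i\<in>I. cobd (F i) xs)"
  by (induction I rule: infinite_finite_induct) (auto simp: cobd_zero cobd_add)

lemma cobd_map: "cobd (\<lambda>l. F (map a l)) xs = cobd F (map a xs)"
proof (induction xs arbitrary: F)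
  case (Cons x xs)
  show ?case using Cons[of "\<lambda>l. F (a x # l)"] by simp
qed simp

lemma cobd_cobd: "cobd (cobd F) xs = 0"
proof (induction xs arbitrary: F)
  case (Cons x xs)
  show ?case using Cons[of "\<lambda>l. F (x # l)"] by (simp add: cobd_diff)
qed simp

lemma prism_add: "prism a b (\<lambda>l. F l + G l) xs = prism a b F xs + prism a b G xs"
  by (induction xs arbitrary: F G) auto

lemma prism_diff: "prism a b (\<lambda>l. F l - G l) xs = prism a b F xs - prism a b G xs"
  by (induction xs arbitrary: F G) auto

text \<open>The prism is a cochain homotopy between the pullbacks along \<open>a\<close> and
  \<open>b\<close>. Fixing the first vertex \<open>a x\<close> gives the same identity one degree
  lower, and the mixed term \<open>F (a x # map b xs)\<close> cancels.\<close>

lemma prism_cobd: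
  "prism a b (cobd F) xs = F (map b xs) - F (map a xs) - cobd (prism a b F) xs"
proof (induction xs arbitrary: F)
  case (Cons x xs)
  show ?case
    using Cons[of "\<lambda>l. F (a x # l)"]
    by (simp add: cobd_diff prism_diff cobd_map[of "\<lambda>l. F (a x # b x # l)"])
qed simp

text \<open>All vertices of the prism lie in the two images; this locality later keeps the
  constructed chains small.\<close>

lemma prism_cong:
  assumes "\<And>l. set l \<subseteq> a ` set xs \<union> b ` set xs \<Longrightarrow> F l = G l"
  shows "prism a b F xs = prism a b G xs"
  using assms
proof (induction xs arbitrary: F G)
  case (Cons x xs)
  have "prism a b (\<lambda>l. F (a x # l)) xs = prism a b (\<lambda>l. G (a x # l)) xs"
    by (rule Cons.IH) (rule Cons.prems, auto)
  moreover have "F (a x # b x # map b xs) = G (a x # b x # map b xs)"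
    by (rule Cons.prems) auto
  ultimately show ?case by simp
qed simp

text \<open>Lets the vanishing of chains on length-only cochains pass from one stage to the next;
  that vanishing removes the constant end of the homotopy.\<close>

lemma prism_length_function:
  "length xs = length ys \<Longrightarrow>
     prism a b (\<lambda>l. c (length l)) xs = prism a' b' (\<lambda>l. c (length l)) ys"
proof (induction xs ys arbitrary: c rule: list_induct2)
  case (Cons x xs y ys)
  show ?case using Cons.IH[of "\<lambda>n. c (Suc n)"] Cons.hyps by simp
qed simp

section \<open>Cup products with 0-cochains and 1-cochains, and products of 2-cocycles\<close>

fun cup0 :: "('x \<Rightarrow> int) \<Rightarrow> ('x list \<Rightarrow> int) \<Rightarrow> 'x list \<Rightarrow> int" where
  "cup0 S G [] = 0"
| "cup0 S G (x # xs) = S x * G (x # xs)"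

fun cup1 :: "('x \<Rightarrow> 'x \<Rightarrow> int) \<Rightarrow> ('x list \<Rightarrow> int) \<Rightarrow> 'x list \<Rightarrow> int" where
  "cup1 e G (x # y # xs) = e x y * G (y # xs)"
| "cup1 e G _ = 0"

lemma cup1_Cons: "cup1 e G (x # l) = cup0 (e x) G l"
  by (cases l) auto

text \<open>Leibniz rule with closed second factor.\<close>

lemma cobd_cup0:
  assumes "\<And>l. cobd G l = 0"
  shows "cobd (cup0 S G) l = cup1 (\<lambda>x y. S y - S x) G l"
proof (cases l)
  case (Cons x l')
  show ?thesis
  proof (cases l')
    case Nil
    then show ?thesis using Cons by simp
  next
    case (Cons y ys)
    have "cobd (\<lambda>l. G (x # l)) (y # ys) = G (y # ys)"
      using assms[of "x # y # ys"] by simp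
    then show ?thesis
      using \<open>l = x # l'\<close> Cons
      by (simp add: cobd_mult left_diff_distrib del: cobd.simps(2)) (simp add: cobd_mult left_diff_distrib)
  qed
qed simp

text \<open>Leibniz rule one degree higher: fixing the first vertex turns \<open>cup1 e\<close> into
  \<open>cup0 (e x)\<close>, so \<open>cobd_cup0\<close> applies.\<close>

lemma cobd_cup1:
  assumes "\<And>l. cobd G l = 0"
  shows "cobd (cup1 e G) (x # y # z # l) = (e y z - e x z + e x y) * G (z # l)"
proof -
  have "(\<lambda>l. cup1 e G (x # l)) = cup0 (e x) G"
    by (auto simp: cup1_Cons)
  then have "cobd (cup1 e G) (x # y # z # l) = cup1 e G (y # z # l) - cobd (cup0 (e x) G) (y # z # l)"
    by (metis cobd.simps(2))
  also have "\<dots> = e y z * G (z # l) - (e x z - e x y) * G (z # l)"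
    using assms by (simp add: cobd_cup0 del: cobd.simps(2))
  finally show ?thesis by (simp add: algebra_simps)
qed

lemma cobd_cup1_short:
  assumes "\<And>l. cobd G l = 0" "length l < 3"
  shows "cobd (cup1 e G) l = 0"
proof -
  consider "l = []" | x where "l = [x]" | x y where "l = [x, y]"
    using assms(2) by (auto simp: less_Suc_eq length_Suc_conv numeral_3_eq_3)
  then show ?thesis by cases (auto simp: cup1_Cons)
qed

text \<open>The cup product of the 2-cocycles \<open>de\<close>, starting from the unit cochain on
  points. Writing it as the coboundary of \<open>e\<close> times the remaining product makes it
  closed at once and exhibits the primitive evaluated later; that primitive need not be
  invariant.\<close>

fun chern_prod :: "('x \<Rightarrow> 'x \<Rightarrow> int) list \<Rightarrow> 'x list \<Rightarrow> int" where
  "chern_prod [] = (\<lambda>l. of_bool (length l = 1))"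
| "chern_prod (e # es) = cobd (cup1 e (chern_prod es))"

lemma cobd_chern_prod:
  fixes l :: "'x list"
  shows "cobd (chern_prod es) l = 0"
proof (cases es)
  case Nil
  have "cobd (\<lambda>l. of_bool (l = [])) xs = of_bool (length xs = 1)" for xs :: "'x list"
    by (cases xs) (auto simp: cobd_zero)
  then show ?thesis
    using Nil by (cases l) auto
qed (simp add: cobd_cobd)

lemma chern_prod_Cons:
  "chern_prod (e # es) (x # y # z # l) = (e y z - e x z + e x y) * chern_prod es (z # l)"
  by (simp only: chern_prod.simps cobd_cup1[OF cobd_chern_prod])

lemma chern_prod_short: "length l < 3 \<Longrightarrow> chern_prod (e # es) l = 0"
  by (simp only: chern_prod.simps cobd_cup1_short[OF cobd_chern_prod])

lemma cup1_map: "cup1 e G (map f l) = cup1 (\<lambda>x y. e (f x) (f y)) (\<lambda>l. G (map f l)) l"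
  by (induction l rule: induct_list012) auto

lemma chern_prod_map:
  "chern_prod es (map f l) = chern_prod (map (\<lambda>e x y. e (f x) (f y)) es) l"
proof (induction es arbitrary: l)
  case (Cons e es)
  then show ?case
    by (simp add: cobd_map[symmetric] cup1_map)
qed simp

text \<open>By \<open>chern_prod_Cons\<close> the product sees each \<open>e\<close> only through
  its coboundary, so invariance of the coboundaries suffices.\<close>

lemma chern_prod_invariant:
  assumes "\<And>e x y z. e \<in> set es \<Longrightarrow> x \<in> X \<Longrightarrow> y \<in> X \<Longrightarrow> z \<in> X \<Longrightarrow>
      e (T y) (T z) - e (T x) (T z) + e (T x) (T y) = e y z - e x z + e x y"
    and "set l \<subseteq> X"
  shows "chern_prod es (map T l) = chern_prod es l"
  using assms
proof (induction es arbitrary: l)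
  case (Cons e es)
  show ?case
  proof (cases "length l < 3")
    case False
    then obtain x y z l' where l: "l = x # y # z # l'"
      by (auto simp: not_less numeral_3_eq_3 Suc_le_length_iff)
    have "chern_prod es (map T (z # l')) = chern_prod es (z # l')"
      by (rule Cons.IH) (use Cons.prems l in auto)
    then show ?thesis
      using Cons.prems l by (simp add: chern_prod_Cons del: chern_prod.simps)
  qed (simp add: chern_prod_short del: chern_prod.simps)
qed simp

text \<open>Each factor is evaluated on three vertices of \<open>l\<close>, so a single factor that
  is trivial there kills the product.\<close>

lemma chern_prod_eq_0:
  assumes "e \<in> set es"
    and "\<And>x y z. x \<in> set l \<Longrightarrow> y \<in> set l \<Longrightarrow> z \<in> set l \<Longrightarrow> e y z - e x z + e x y = 0"
  shows "chern_prod es l = 0"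
  using assms
proof (induction es arbitrary: l)
  case (Cons e' es)
  show ?case
  proof (cases "length l < 3")
    case False
    then obtain x y z l' where l: "l = x # y # z # l'"
      by (auto simp: not_less numeral_3_eq_3 Suc_le_length_iff)
    show ?thesis
    proof (cases "e = e'")
      case True
      then show ?thesis
        using Cons.prems(2)[of x y z] l by (simp add: chern_prod_Cons del: chern_prod.simps)
    next
      case False
      have "chern_prod es (z # l') = 0"
        by (rule Cons.IH) (use Cons.prems l False in auto)
      then show ?thesis
        using l by (simp add: chern_prod_Cons del: chern_prod.simps)
    qed
  qed (simp add: chern_prod_short del: chern_prod.simps)
qed simp

section \<open>Chains as functionals\<close>

definition additive_functional :: "(('x list \<Rightarrow> int) \<Rightarrow> int) \<Rightarrow> bool" where
  "additive_functional L \<longleftrightarrow> (\<forall>F G. L (\<lambda>l. F l + G l) = L F + L G)"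

lemma additive_functional_add:
  "additive_functional L \<Longrightarrow> L (\<lambda>l. F l + G l) = L F + L G"
  by (simp add: additive_functional_def)

lemma additive_functional_diff:
  assumes "additive_functional L"
  shows "L (\<lambda>l. F l - G l) = L F - L G"
  using additive_functional_add[OF assms, of "\<lambda>l. F l - G l" G] by simp

lemma additive_functional_zero:
  assumes "additive_functional L"
  shows "L (\<lambda>l. 0) = 0"
  using additive_functional_add[OF assms, of "\<lambda>l. 0" "\<lambda>l. 0"] by simp

lemma additive_functional_mult:
  assumes "additive_functional L"
  shows "L (\<lambda>l. c * F l) = c * L F"
proof (induction c rule: int_induct[where k = 0])
  case base
  then show ?case using additive_functional_zero[OF assms] by simp
next
  case (step1 i)
  then show ?case
    using additive_functional_add[OF assms, of "\<lambda>l. i * F l" F] by (simp add: distrib_right)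
next
  case (step2 i)
  then show ?case
    using additive_functional_diff[OF assms, of "\<lambda>l. i * F l" F] by (simp add: left_diff_distrib)
qed

text \<open>The simplices of the Vietoris complex at scale \<open>R\<close>.\<close>

definition small_lists :: "'x set \<Rightarrow> ('x \<Rightarrow> 'x \<Rightarrow> bool) \<Rightarrow> 'x list set" where
  "small_lists X R = {l. set l \<subseteq> X \<and> (\<forall>x\<in>set l. \<forall>y\<in>set l. R x y)}"

text \<open>A chain is represented by the functional that evaluates cochains on it.\<close>

definition chain_on :: "'x list set \<Rightarrow> (('x list \<Rightarrow> int) \<Rightarrow> int) \<Rightarrow> bool" where
  "chain_on Q L \<longleftrightarrow> additive_functional L \<and> (\<forall>F G. (\<forall>l\<in>Q. F l = G l) \<longrightarrow> L F = L G)"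

lemma chain_on_cong:
  "chain_on Q L \<Longrightarrow> (\<And>l. l \<in> Q \<Longrightarrow> F l = G l) \<Longrightarrow> L F = L G"
  by (simp add: chain_on_def)

text \<open>On \<open>Q\<close> the difference is \<open>m\<close> times an integer cochain, and
  \<open>L\<close> is linear over the integers.\<close>

lemma chain_on_cong_mod:
  assumes "chain_on Q L" "\<And>l. l \<in> Q \<Longrightarrow> [F l = G l] (mod m)"
  shows "[L F = L G] (mod m)"
proof -
  have add: "additive_functional L"
    using assms(1) by (simp add: chain_on_def)
  have "L F = L (\<lambda>l. G l + m * ((F l - G l) div m))"
    using assms by (intro chain_on_cong[OF assms(1)]) (auto simp: cong_iff_dvd_diff)
  also have "\<dots> = L G + m * L (\<lambda>l. (F l - G l) div m)"
    by (simp only: additive_functional_add[OF add] additive_functional_mult[OF add])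
  finally show ?thesis by (simp add: cong_def)
qed

section \<open>Equivariant contractible self-maps\<close>

text \<open>The family \<open>\<U>\<close> plays the role of a uniformity. For each required precision \<open>R\<close>, the homotopy
  from \<open>x0\<close> to \<open>f\<close> can be sampled at times \<open>0, \<dots>, n\<close> so that the prisms over \<open>R'\<close>-small
  simplices are \<open>R\<close>-small.\<close>

locale cyclic_contraction =
  fixes k :: nat and X :: "'x set" and T f :: "'x \<Rightarrow> 'x" and x0 :: 'x
    and \<U> :: "('x \<Rightarrow> 'x \<Rightarrow> bool) set"
  assumes k2: "k \<ge> 2"
    and T_X: "x \<in> X \<Longrightarrow> T x \<in> X"
    and f_X: "x \<in> X \<Longrightarrow> f x \<in> X"
    and x0_X: "x0 \<in> X"
    and T_order: "(T ^^ k) x = x"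
    and f_T: "f (T x) = T (f x)"
    and x0_small: "R \<in> \<U> \<Longrightarrow> R x0 x0"
    and contraction: "R \<in> \<U> \<Longrightarrow> \<exists>R'\<in>\<U>. \<exists>n H.
        (\<forall>x\<in>X. H 0 x = x0 \<and> H n x = f x) \<and> (\<forall>i\<le>n. \<forall>x\<in>X. H i x \<in> X) \<and>
        (\<forall>x\<in>X. \<forall>y\<in>X. R' x y \<longrightarrow> (\<forall>g<k. \<forall>i<n. \<forall>a\<in>{H i, H (Suc i)}. \<forall>b\<in>{H i, H (Suc i)}.
           R (a ((T ^^ g) x)) (b ((T ^^ g) y))))"
begin

lemma Tg_X: "x \<in> X \<Longrightarrow> (T ^^ g) x \<in> X"
  by (induction g) (auto simp: T_X)

text \<open>The group ring element with coefficients \<open>w g\<close> at \<open>T ^^ g\<close>,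
  acting on cochains.\<close>

definition twist :: "(nat \<Rightarrow> int) \<Rightarrow> ('x list \<Rightarrow> int) \<Rightarrow> 'x list \<Rightarrow> int" where
  "twist w F l = (\<Sum>g<k. w g * F (map (T ^^ g) l))"

lemma cobd_twist: "cobd (twist w F) l = twist w (cobd F) l"
  unfolding twist_def[abs_def] by (simp add: cobd_sum cobd_mult cobd_map)

lemma twist_add: "twist w (\<lambda>l. F l + G l) l = twist w F l + twist w G l"
  by (simp add: twist_def sum.distrib distrib_left)

text \<open>\<open>L'\<close> is the discretised homotopy applied to the twist of \<open>L\<close>.
  Its boundary has three terms: the image under \<open>f\<close> survives, the constant end sees
  only lengths and vanishes by the third hypothesis, and the last vanishes because the twisted chain
  is closed.\<close>

lemma extend_chain:
  assumes "R \<in> \<U>"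
  obtains R' where "R' \<in> \<U>"
    "\<And>L w. chain_on (small_lists X R') L \<Longrightarrow> (\<And>F. L (cobd (twist w F)) = 0) \<Longrightarrow>
       (\<And>c. L (twist w (\<lambda>l. c (length l))) = 0) \<Longrightarrow>
       \<exists>L'. chain_on (small_lists X R) L' \<and> (\<forall>F. L' (cobd F) = L (twist w (\<lambda>l. F (map f l)))) \<and>
         (\<forall>c. L' (\<lambda>l. c (length l)) = 0)"
proof -
  obtain R' n H where R': "R' \<in> \<U>"
    and H0: "\<And>x. x \<in> X \<Longrightarrow> H 0 x = x0" and Hn: "\<And>x. x \<in> X \<Longrightarrow> H n x = f x"
    and HX: "\<And>i x. i \<le> n \<Longrightarrow> x \<in> X \<Longrightarrow> H i x \<in> X"
    and HR: "\<And>x y g i a b. x \<in> X \<Longrightarrow> y \<in> X \<Longrightarrow> R' x y \<Longrightarrow> g < k \<Longrightarrow> i < n \<Longrightarrow>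
        a \<in> {H i, H (Suc i)} \<Longrightarrow> b \<in> {H i, H (Suc i)} \<Longrightarrow> R (a ((T ^^ g) x)) (b ((T ^^ g) y))"
  proof -
    from contraction[OF assms] obtain R' n H where "R' \<in> \<U>" and
      *: "\<forall>x\<in>X. H 0 x = x0 \<and> H n x = f x" "\<forall>i\<le>n. \<forall>x\<in>X. H i x \<in> X"
        "\<forall>x\<in>X. \<forall>y\<in>X. R' x y \<longrightarrow> (\<forall>g<k. \<forall>i<n. \<forall>a\<in>{H i, H (Suc i)}. \<forall>b\<in>{H i, H (Suc i)}.
           R (a ((T ^^ g) x)) (b ((T ^^ g) y)))"
      by auto
    show thesis
      by (rule that[OF \<open>R' \<in> \<U>\<close>, of H n]) (use * in blast)+
  qed
  \<comment> \<open>Prisms between consecutive samples; in \<open>h_cobd\<close> the intermediate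
    pullbacks telescope, leaving those along \<open>H n\<close> and \<open>H 0\<close>.\<close>
  define h where "h F l = (\<Sum>i<n. prism (H i) (H (Suc i)) F l)" for F l
  have h_add: "h (\<lambda>l. F l + G l) l = h F l + h G l" for F G l
    by (simp add: h_def prism_add sum.distrib)
  have h_cobd: "h (cobd F) l = F (map (H n) l) - F (map (H 0) l) - cobd (h F) l" for F l
    using sum_lessThan_telescope[of "\<lambda>i. F (map (H i) l)" n] unfolding h_def[abs_def]
    by (simp add: cobd_sum prism_cobd sum_subtractf)
  have h_cong: "h F (map (T ^^ g) l) = h G (map (T ^^ g) l)"
    if "\<forall>l\<in>small_lists X R. F l = G l" "l \<in> small_lists X R'" "g < k" for F G l g
    unfolding h_def
  proof (intro sum.cong prism_cong refl)
    fix i l'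
    assume i: "i \<in> {..<n}" and l': "set l' \<subseteq> H i ` set (map (T ^^ g) l) \<union> H (Suc i) ` set (map (T ^^ g) l)"
    have l: "set l \<subseteq> X" "\<And>x y. x \<in> set l \<Longrightarrow> y \<in> set l \<Longrightarrow> R' x y"
      using that(2) by (auto simp: small_lists_def)
    have ex: "\<exists>a\<in>{H i, H (Suc i)}. \<exists>x\<in>set l. u = a ((T ^^ g) x)" if "u \<in> set l'" for u
      using that l' by auto
    have "u \<in> X" if "u \<in> set l'" for u
      using ex[OF that] l i by (auto simp: HX Tg_X subset_iff)
    moreover have "R u v" if uv: "u \<in> set l'" "v \<in> set l'" for u v
    proof -
      obtain a x where a: "a \<in> {H i, H (Suc i)}" "x \<in> set l" "u = a ((T ^^ g) x)"
        using ex[OF uv(1)] by blast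
      obtain b y where b: "b \<in> {H i, H (Suc i)}" "y \<in> set l" "v = b ((T ^^ g) y)"
        using ex[OF uv(2)] by blast
      show ?thesis
        unfolding a(3) b(3) by (rule HR[OF _ _ _ _ _ a(1) b(1)]) (use a b l i \<open>g < k\<close> in auto)
    qed
    ultimately have "l' \<in> small_lists X R"
      by (auto simp: small_lists_def)
    then show "F l' = G l'" using \<open>\<forall>l\<in>small_lists X R. F l = G l\<close> by blast
  qed
  \<comment> \<open>\<open>replicate\<close> only supplies a canonical list of the given length,
    which brings the cochain into the form that \<open>len\<close> handles.\<close>
  have h_length: "h (\<lambda>l. c (length l)) = (\<lambda>l. h (\<lambda>l. c (length l)) (replicate (length l) x0))" for c
    unfolding h_def by (intro ext sum.cong refl prism_length_function) simp
  show thesis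
  proof (rule that[OF R'])
    fix L w
    assume L: "chain_on (small_lists X R') L" and closed: "\<And>F. L (cobd (twist w F)) = 0"
      and len: "\<And>c. L (twist w (\<lambda>l. c (length l))) = 0"
    have add: "additive_functional L"
      using L by (simp add: chain_on_def)
    define L' where "L' F = L (twist w (h F))" for F
    have "additive_functional L'"
      unfolding additive_functional_def L'_def
      by (simp add: h_add[abs_def] twist_add[abs_def] additive_functional_add[OF add])
    moreover have "L' F = L' G" if "\<forall>l\<in>small_lists X R. F l = G l" for F G
      unfolding L'_def
      by (rule chain_on_cong[OF L]) (simp add: twist_def h_cong[OF that])
    moreover have "L' (cobd F) = L (twist w (\<lambda>l. F (map f l)))" for F
    proof -
      have "L' (cobd F) = L (\<lambda>l. twist w (\<lambda>l. F (map f l)) l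
          - twist w (\<lambda>l. F (replicate (length l) x0)) l - cobd (twist w (h F)) l)"
        unfolding L'_def
      proof (rule chain_on_cong[OF L])
        fix l assume "l \<in> small_lists X R'"
        then have l: "set (map (T ^^ g) l) \<subseteq> X" for g
          by (auto simp: small_lists_def Tg_X)
        have "map (H n) (map (T ^^ g) l) = map f (map (T ^^ g) l)"
          "map (H 0) (map (T ^^ g) l) = replicate (length (map (T ^^ g) l)) x0" for g
          using l[of g] by (auto simp: Hn H0 subset_iff intro!: nth_equalityI)
        then show "twist w (h (cobd F)) l = twist w (\<lambda>l. F (map f l)) l
            - twist w (\<lambda>l. F (replicate (length l) x0)) l - cobd (twist w (h F)) l"
          by (simp add: twist_def cobd_twist h_cobd sum_subtractf right_diff_distrib
                del: map_map map_eq_conv)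
      qed
      then show ?thesis
        using len[of "\<lambda>m. F (replicate m x0)"] closed[of "h F"]
        by (simp add: additive_functional_diff[OF add])
    qed
    moreover have "L' (\<lambda>l. c (length l)) = 0" for c
      unfolding L'_def by (subst h_length) (rule len)
    ultimately show "\<exists>L'. chain_on (small_lists X R) L' \<and>
        (\<forall>F. L' (cobd F) = L (twist w (\<lambda>l. F (map f l)))) \<and> (\<forall>c. L' (\<lambda>l. c (length l)) = 0)"
      unfolding chain_on_def by blast
  qed
qed

section \<open>The group ring elements \<open>T - 1\<close> and \<open>N\<close>, and the chains
  imitating the periodic resolution\<close>

definition wdiff :: "nat \<Rightarrow> int" where
  "wdiff g = (if g = 0 then - 1 else if g = 1 then 1 else 0)"

lemma twist_wdiff: "twist wdiff F l = F (map T l) - F l"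
proof -
  have "twist wdiff F l = (\<Sum>g\<in>{0,1}. wdiff g * F (map (T ^^ g) l))"
    unfolding twist_def using k2 by (intro sum.mono_neutral_right) (auto simp: wdiff_def)
  then show ?thesis by (simp add: wdiff_def)
qed

lemma sum_shift:
  fixes F :: "'x list \<Rightarrow> 'b::ab_group_add"
  shows "(\<Sum>g<k. F (map (T ^^ Suc g) l)) = (\<Sum>g<k. F (map (T ^^ g) l))"
proof -
  have "map (T ^^ k) l = map (T ^^ 0) l"
    by (simp add: map_idI T_order)
  then have "(\<Sum>g<Suc k. F (map (T ^^ g) l)) = F (map (T ^^ 0) l) + (\<Sum>g<k. F (map (T ^^ g) l))"
    by (simp add: add.commute)
  then show ?thesis
    by (subst (asm) sum.lessThan_Suc_shift) simp
qed

lemma f_Tg: "f ((T ^^ g) x) = (T ^^ g) (f x)"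
  by (induction g) (auto simp: f_T)

text \<open>This relation and the next are \<open>N T = N\<close> and \<open>N (T - 1) = 0\<close>;
  they make the successive twisted chains closed.\<close>

lemma twist_one_shift: "twist (\<lambda>_. 1) F (map T l) = twist (\<lambda>_. 1) F l"
  using sum_shift[of F l] by (simp add: twist_def funpow_Suc_right del: funpow.simps(2))

lemma twist_one_diff: "twist (\<lambda>_. 1) (\<lambda>l. F (map T l) - F l) l = 0"
  using sum_shift[of F l] by (simp add: twist_def sum_subtractf o_def)

text \<open>The coboundary of \<open>e\<close> is invariant although \<open>e\<close> is not; the two congruences say that its class
  transgresses to \<open>- 1\<close>.\<close>

definition chern_cochain :: "('x \<Rightarrow> 'x \<Rightarrow> int) \<Rightarrow> bool" where
  "chern_cochain e \<longleftrightarrow>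
     (\<forall>x\<in>X. \<forall>y\<in>X. \<forall>z\<in>X. e (T y) (T z) - e (T x) (T z) + e (T x) (T y) = e y z - e x z + e x y) \<and>
     (\<exists>S. (\<forall>x\<in>X. \<forall>y\<in>X. [(\<Sum>g<k. e ((T ^^ g) x) ((T ^^ g) y)) = S y - S x] (mod int k)) \<and>
          (\<forall>x\<in>X. [S (T x) - S x = - 1] (mod int k)))"

lemma chern_cochain_f:
  assumes "chern_cochain e"
  shows "chern_cochain (\<lambda>x y. e (f x) (f y))"
proof -
  obtain S where S: "\<forall>x\<in>X. \<forall>y\<in>X. [(\<Sum>g<k. e ((T ^^ g) x) ((T ^^ g) y)) = S y - S x] (mod int k)"
    "\<forall>x\<in>X. [S (T x) - S x = - 1] (mod int k)"
    using assms by (auto simp: chern_cochain_def)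
  then have "\<forall>x\<in>X. \<forall>y\<in>X. [(\<Sum>g<k. e (f ((T ^^ g) x)) (f ((T ^^ g) y))) = S (f y) - S (f x)] (mod int k)"
    "\<forall>x\<in>X. [S (f (T x)) - S (f x) = - 1] (mod int k)"
    by (simp_all add: f_T f_Tg f_X)
  moreover have "\<forall>x\<in>X. \<forall>y\<in>X. \<forall>z\<in>X. e (f (T y)) (f (T z)) - e (f (T x)) (f (T z)) + e (f (T x)) (f (T y))
      = e (f y) (f z) - e (f x) (f z) + e (f x) (f y)"
    using assms by (simp add: chern_cochain_def f_T f_X)
  ultimately show ?thesis
    unfolding chern_cochain_def by (intro conjI exI[of _ "\<lambda>x. S (f x)"])
qed

lemma chern_prod_T:
  assumes "\<forall>e\<in>set es. chern_cochain e" "set l \<subseteq> X"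
  shows "chern_prod es (map T l) = chern_prod es l"
  using assms by (intro chern_prod_invariant) (auto simp: chern_cochain_def)

lemma chern_prod_Tg:
  assumes "\<forall>e\<in>set es. chern_cochain e" "set l \<subseteq> X"
  shows "chern_prod es (map (T ^^ g) l) = chern_prod es l"
proof (induction g)
  case (Suc g)
  have "chern_prod es (map T (map (T ^^ g) l)) = chern_prod es (map (T ^^ g) l)"
    by (rule chern_prod_T) (use assms Tg_X in auto)
  then show ?case using Suc by (simp add: o_def)
qed simp

text \<open>\<open>L\<close> is evaluation on the chain of degree \<open>2 m\<close>. The scale is
  arbitrary because each step of the induction costs precision twice, and all \<open>es\<close> are
  treated at once because the step pulls the factors back along \<open>f\<close>.\<close>

lemma fundamental_chain:
  assumes "R \<in> \<U>"
  shows "\<exists>L. chain_on (small_lists X R) L \<and> (\<forall>F. L (cobd (twist wdiff F)) = 0) \<and>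
     (\<forall>es. length es = m \<longrightarrow> (\<forall>e\<in>set es. chern_cochain e) \<longrightarrow>
        [L (chern_prod es) = (- 1) ^ m] (mod int k))"
  using assms
proof (induction m arbitrary: R)
  case 0
  have "chain_on (small_lists X R) (\<lambda>F. F [x0])"
    using x0_X x0_small[OF 0] by (simp add: chain_on_def additive_functional_def small_lists_def)
  then show ?case
    by (intro exI[of _ "\<lambda>F. F [x0]"]) (simp add: twist_wdiff)
next
  case (Suc m)
  \<comment> \<open>Scales are chosen backwards: \<open>L\<close> lives at \<open>R2\<close>,
    \<open>L1\<close> of odd degree at \<open>R1\<close>, and \<open>L2\<close> at
    \<open>R\<close>.\<close>
  obtain R1 where R1: "R1 \<in> \<U>" and
    ext1: "\<And>L w. chain_on (small_lists X R1) L \<Longrightarrow> (\<And>F. L (cobd (twist w F)) = 0) \<Longrightarrow>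
       (\<And>c. L (twist w (\<lambda>l. c (length l))) = 0) \<Longrightarrow>
       \<exists>L'. chain_on (small_lists X R) L' \<and> (\<forall>F. L' (cobd F) = L (twist w (\<lambda>l. F (map f l)))) \<and>
         (\<forall>c. L' (\<lambda>l. c (length l)) = 0)"
    using extend_chain[OF Suc.prems] by metis
  obtain R2 where R2: "R2 \<in> \<U>" and
    ext2: "\<And>L w. chain_on (small_lists X R2) L \<Longrightarrow> (\<And>F. L (cobd (twist w F)) = 0) \<Longrightarrow>
       (\<And>c. L (twist w (\<lambda>l. c (length l))) = 0) \<Longrightarrow>
       \<exists>L'. chain_on (small_lists X R1) L' \<and> (\<forall>F. L' (cobd F) = L (twist w (\<lambda>l. F (map f l)))) \<and>
         (\<forall>c. L' (\<lambda>l. c (length l)) = 0)"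
    using extend_chain[OF R1] by metis
  obtain L where L: "chain_on (small_lists X R2) L" and L_closed: "\<And>F. L (cobd (twist wdiff F)) = 0"
    and L_chern: "\<And>es. length es = m \<Longrightarrow> (\<forall>e\<in>set es. chern_cochain e) \<Longrightarrow>
        [L (chern_prod es) = (- 1) ^ m] (mod int k)"
    using Suc.IH[OF R2] by blast
  have L_add: "additive_functional L"
    using L by (simp add: chain_on_def)
  have "L (twist wdiff (\<lambda>l. c (length l))) = 0" for c
    by (simp add: twist_wdiff[abs_def] additive_functional_zero[OF L_add])
  from ext2[OF L L_closed this] obtain L1 where L1: "chain_on (small_lists X R1) L1"
    and L1_cobd: "\<And>F. L1 (cobd F) = L (twist wdiff (\<lambda>l. F (map f l)))"
    and L1_len: "\<And>c. L1 (\<lambda>l. c (length l)) = 0"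
    by blast
  have L1_add: "additive_functional L1"
    using L1 by (simp add: chain_on_def)
  have "map f (map T l) = map T (map f l)" for l
    by (simp add: f_T)
  then have "L1 (cobd (twist (\<lambda>_. 1) F)) = 0" for F
    by (simp add: L1_cobd twist_wdiff[abs_def] twist_one_shift additive_functional_zero[OF L_add]
        del: map_map)
  moreover have "L1 (twist (\<lambda>_. 1) (\<lambda>l. c (length l))) = 0" for c
    using L1_len[of "\<lambda>n. int k * c n"] by (simp add: twist_def[abs_def])
  ultimately obtain L2 where L2: "chain_on (small_lists X R) L2"
    and L2_cobd: "\<And>F. L2 (cobd F) = L1 (twist (\<lambda>_. 1) (\<lambda>l. F (map f l)))"
    using ext1[OF L1, of "\<lambda>_. 1"] by blast
  have "L2 (cobd (twist wdiff F)) = 0" for F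
  proof -
    have "(\<lambda>l. twist wdiff F (map f l)) = (\<lambda>l. F (map f (map T l)) - F (map f l))"
      by (simp add: twist_wdiff f_T o_def)
    then have "twist (\<lambda>_. 1) (\<lambda>l. twist wdiff F (map f l)) = (\<lambda>l. 0)"
      using twist_one_diff[of "\<lambda>l. F (map f l)"] by (auto simp del: map_map)
    then show ?thesis
      by (simp add: L2_cobd additive_functional_zero[OF L1_add])
  qed
  moreover have "[L2 (chern_prod es) = (- 1) ^ Suc m] (mod int k)"
    if len: "length es = Suc m" and ch: "\<forall>e\<in>set es. chern_cochain e" for es
  proof -
    obtain e es' where es: "es = e # es'"
      using len by (cases es) auto
    define e1 where "e1 = (\<lambda>x y. e (f x) (f y))"
    define es1 where "es1 = map (\<lambda>e x y. e (f x) (f y)) es'"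
    define es2 where "es2 = map (\<lambda>e x y. e (f x) (f y)) es1"
    define G where "G = chern_prod es1"
    have ch1: "chern_cochain e1" "\<forall>e\<in>set es1. chern_cochain e" "\<forall>e\<in>set es2. chern_cochain e"
      using ch by (auto simp: es e1_def es1_def es2_def intro!: chern_cochain_f)
    obtain S where S1: "\<And>x y. x \<in> X \<Longrightarrow> y \<in> X \<Longrightarrow>
          [(\<Sum>g<k. e1 ((T ^^ g) x) ((T ^^ g) y)) = S y - S x] (mod int k)"
      and S2: "\<And>x. x \<in> X \<Longrightarrow> [S (T x) - S x = - 1] (mod int k)"
      using ch1(1) unfolding chern_cochain_def by blast
    have "L2 (chern_prod es) = L1 (twist (\<lambda>_. 1) (\<lambda>l. cup1 e (chern_prod es') (map f l)))"
      by (simp add: es L2_cobd)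
    also have "(\<lambda>l. cup1 e (chern_prod es') (map f l)) = cup1 e1 G"
      by (simp add: cup1_map chern_prod_map e1_def G_def es1_def)
    \<comment> \<open>\<open>G\<close> is invariant and factors out of the sum over the group, and
      the remaining sum of \<open>e1\<close> is \<open>dS\<close> modulo \<open>k\<close>.\<close>
    also have "[L1 (twist (\<lambda>_. 1) (cup1 e1 G)) = L1 (cup1 (\<lambda>x y. S y - S x) G)] (mod int k)"
    proof (rule chain_on_cong_mod[OF L1])
      fix l assume "l \<in> small_lists X R1"
      then have l: "set l \<subseteq> X" by (simp add: small_lists_def)
      show "[twist (\<lambda>_. 1) (cup1 e1 G) l = cup1 (\<lambda>x y. S y - S x) G l] (mod int k)"
      proof (cases "length l < 2")
        case True
        then have "cup1 u G l = 0" "cup1 u G (map (T ^^ g) l) = 0" for u g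
          by (cases l; simp add: cup1_Cons)+
        then show ?thesis by (simp add: twist_def)
      next
        case False
        then obtain x y l' where l': "l = x # y # l'"
          by (auto simp: not_less numeral_2_eq_2 Suc_le_length_iff)
        have "G (map (T ^^ g) (y # l')) = G (y # l')" for g
          unfolding G_def by (rule chern_prod_Tg) (use ch1 l l' in auto)
        then have "twist (\<lambda>_. 1) (cup1 e1 G) l = (\<Sum>g<k. e1 ((T ^^ g) x) ((T ^^ g) y)) * G (y # l')"
          by (simp add: twist_def l' sum_distrib_right)
        also have "[\<dots> = (S y - S x) * G (y # l')] (mod int k)"
          using l l' by (intro cong_mult S1 cong_refl) auto
        finally show ?thesis by (simp add: l')
      qed
    qed
    \<comment> \<open>As \<open>G\<close> is closed, \<open>dS\<close> times \<open>G\<close> is a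
      coboundary, so the boundary formula of \<open>L1\<close> leads back to
      \<open>L\<close>.\<close>
    also have "L1 (cup1 (\<lambda>x y. S y - S x) G) = L1 (cobd (cup0 S G))"
      unfolding G_def ext[OF cobd_cup0[OF cobd_chern_prod]] ..
    also have "\<dots> = L (\<lambda>l. cup0 S G (map f (map T l)) - cup0 S G (map f l))"
      by (simp add: L1_cobd twist_wdiff[abs_def])
    \<comment> \<open>Translation by \<open>T\<close> changes \<open>S\<close> by \<open>-1\<close>
      and fixes \<open>G\<close>: this is the one sign gained per factor.\<close>
    also have "[\<dots> = L (\<lambda>l. - 1 * chern_prod es2 l)] (mod int k)"
    proof (rule chain_on_cong_mod[OF L])
      fix l assume "l \<in> small_lists X R2"
      then have l: "set l \<subseteq> X" by (simp add: small_lists_def)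
      have G: "G (map f l) = chern_prod es2 l" 
        by (simp add: G_def es2_def chern_prod_map)
      have GT: "G (map T (map f l)) = G (map f l)"
        unfolding G_def by (rule chern_prod_T) (use ch1 l f_X in auto)
      show "[cup0 S G (map f (map T l)) - cup0 S G (map f l) = - 1 * chern_prod es2 l] (mod int k)"
      proof (cases l)
        case Nil
        have "G [] = 0"
          by (cases es1) (simp_all add: G_def)
        then show ?thesis using G Nil by simp
      next
        case (Cons x l')
        have "cup0 S G (map f (map T l)) - cup0 S G (map f l)
            = (S (T (f x)) - S (f x)) * G (map f l)"
          using GT Cons by (simp add: f_T o_def left_diff_distrib)
        also have "[\<dots> = - 1 * G (map f l)] (mod int k)"
          using l Cons by (intro cong_mult S2 cong_refl f_X) auto
        finally show ?thesis using G by simp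
      qed
    qed
    also have "L (\<lambda>l. - 1 * chern_prod es2 l) = - 1 * L (chern_prod es2)"
      by (rule additive_functional_mult[OF L_add])
    also have "[\<dots> = - 1 * (- 1) ^ m] (mod int k)"
      using len ch1 by (intro cong_mult cong_refl L_chern) (auto simp: es es1_def es2_def)
    finally show ?thesis by simp
  qed
  ultimately show ?case using L2 by blast
qed

text \<open>Otherwise the fundamental chain would evaluate to 0, which is not congruent to
  \<open>1\<close> or \<open>-1\<close> modulo \<open>k\<close>.\<close>

lemma chern_prod_nonvanishing:
  assumes "R \<in> \<U>" "\<forall>e\<in>set es. chern_cochain e"
  shows "\<exists>l\<in>small_lists X R. chern_prod es l \<noteq> 0"
proof (rule ccontr)
  assume vanish: "\<not> ?thesis"
  obtain L where L: "chain_on (small_lists X R) L"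
    and cong: "[L (chern_prod es) = (- 1) ^ length es] (mod int k)"
    using fundamental_chain[OF assms(1), of "length es"] assms(2) by blast
  have "L (chern_prod es) = L (\<lambda>l. 0)"
    using vanish by (intro chain_on_cong[OF L]) auto
  also have "\<dots> = 0"
    using L additive_functional_zero by (auto simp: chain_on_def)
  finally have "int k dvd (- 1) ^ length es"
    using cong by (simp add: cong_iff_dvd_diff)
  then have "int k dvd 1"
    by (cases "even (length es)") auto
  then show False using k2 by simp
qed

end

section \<open>Cocycles from phases of eigenfunctions\<close>

text \<open>The quotient is an integer if \<open>B x\<close> and \<open>B y\<close> are nonzero. Its coboundary only involves the
  ratios of values of \<open>B\<close>, which makes it invariant.\<close>

definition phase_cochain :: "('x \<Rightarrow> complex) \<Rightarrow> 'x \<Rightarrow> 'x \<Rightarrow> int" where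
  "phase_cochain B x y = \<lfloor>(Arg (B y) - Arg (B x) - Arg (B y / B x)) / (2 * pi)\<rfloor>"

lemma real_of_int_floor_phase:
  assumes "cis t = 1"
  shows "real_of_int \<lfloor>t / (2 * pi)\<rfloor> = t / (2 * pi)"
  using assms by (auto simp: cis_eq_1_iff)

lemma phase_cochain_real:
  assumes "B x \<noteq> 0" "B y \<noteq> 0"
  shows "real_of_int (phase_cochain B x y) = (Arg (B y) - Arg (B x) - Arg (B y / B x)) / (2 * pi)"
  unfolding phase_cochain_def
proof (rule real_of_int_floor_phase)
  show "cis (Arg (B y) - Arg (B x) - Arg (B y / B x)) = 1"
    using assms by (simp add: cis_divide[symmetric] cis_Arg sgn_divide sgn_zero_iff)
qed

lemma phase_cochain_cobd:
  assumes "B x \<noteq> 0" "B y \<noteq> 0" "B z \<noteq> 0"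
  shows "real_of_int (phase_cochain B y z - phase_cochain B x z + phase_cochain B x y) =
    (Arg (B z / B x) - Arg (B z / B y) - Arg (B y / B x)) / (2 * pi)"
  using assms by (simp add: phase_cochain_real diff_divide_distrib)

text \<open>The bounds put the three ratios in the right half-plane, so the arguments add up to less
  than \<open>2 * pi\<close> in absolute value; the integer in question is therefore smaller than 1
  in absolute value.\<close>

lemma phase_cochain_cobd_eq_0:
  assumes "cmod (B y - B x) < cmod (B x)" "cmod (B z - B x) < cmod (B x)" "cmod (B z - B y) < cmod (B y)"
    and "B z \<noteq> 0"
  shows "phase_cochain B y z - phase_cochain B x z + phase_cochain B x y = 0"
proof -
  have Arg: "\<bar>Arg (w / v)\<bar> < pi / 2" if "cmod (w - v) < cmod v" for v w
  proof -
    have "v \<noteq> 0" using that by auto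
    then have "cmod (w / v - 1) < 1"
      using that by (simp add: diff_divide_eq_iff norm_divide divide_simps)
    then have "Re (w / v) > 0"
      using complex_Re_le_cmod[of "1 - w / v"] by (simp add: norm_minus_commute)
    then show ?thesis by (simp only: Arg_Re_pos simp_thms)
  qed
  have nz: "B x \<noteq> 0" "B y \<noteq> 0" using assms by auto
  have "\<bar>Arg (B z / B x) - Arg (B z / B y) - Arg (B y / B x)\<bar> < 2 * pi"
    using Arg[OF assms(1)] Arg[OF assms(2)] Arg[OF assms(3)] pi_gt_zero by linarith
  then have "\<bar>real_of_int (phase_cochain B y z - phase_cochain B x z + phase_cochain B x y)\<bar> < 1"
    unfolding phase_cochain_cobd[of B, OF nz assms(4)] by (simp add: abs_divide)
  then show ?thesis by linarith
qed

context cyclic_contraction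
begin

lemma chern_cochain_phase:
  assumes nz: "\<And>x. x \<in> X \<Longrightarrow> B x \<noteq> 0" and equiv: "\<And>x. x \<in> X \<Longrightarrow> B (T x) = cis (2 * pi / k) * B x"
  shows "chern_cochain (phase_cochain B)"
  unfolding chern_cochain_def
proof (intro conjI ballI exI)
  have Tg: "B ((T ^^ g) x) = cis (2 * pi * g / k) * B x" if "x \<in> X" for g x
    using that
  proof (induction g)
    case (Suc g)
    have "B ((T ^^ Suc g) x) = cis (2 * pi / k) * (cis (2 * pi * g / k) * B x)"
      using Suc by (simp add: equiv Tg_X)
    also have "\<dots> = cis (2 * pi * Suc g / k) * B x"
      by (simp add: mult.assoc[symmetric] cis_mult add_divide_distrib distrib_left)
    finally show ?case .
  qed simp
  \<comment> \<open>The branch correction between the argument along the orbit and its expected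
    value; the sum of these corrections is the transgression \<open>S\<close>.\<close>
  define m where "m g x = \<lfloor>(Arg (B ((T ^^ g) x)) - Arg (B x) - 2 * pi * g / k) / (2 * pi)\<rfloor>" for g x
  define S where "S x = (\<Sum>g<k. m g x)" for x
  define \<Theta> where "\<Theta> x = (\<Sum>g<k. Arg (B ((T ^^ g) x)))" for x
  define c where "c = (\<Sum>g<k. 2 * pi * g / k)"
  have m: "real_of_int (m g x) = (Arg (B ((T ^^ g) x)) - Arg (B x) - 2 * pi * g / k) / (2 * pi)"
    if "x \<in> X" for g x
    unfolding m_def
  proof (rule real_of_int_floor_phase)
    show "cis (Arg (B ((T ^^ g) x)) - Arg (B x) - 2 * pi * g / k) = 1"
      using that nz[OF that] nz[OF Tg_X[OF that, of g]]
      by (simp add: cis_divide[symmetric] cis_Arg Tg sgn_mult)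
        (simp add: sgn_div_norm)
  qed
  have S: "real_of_int (S x) = (\<Theta> x - k * Arg (B x) - c) / (2 * pi)" if "x \<in> X" for x
    using that by (simp add: S_def m \<Theta>_def c_def sum_subtractf sum_divide_distrib[symmetric])
  \<comment> \<open>\<open>sum_shift\<close> is stated for lists, so a point is passed as a
    singleton and read off by \<open>hd\<close>.\<close>
  have \<Theta>: "\<Theta> (T x) = \<Theta> x" for x
    using sum_shift[of "\<lambda>l. Arg (B (hd l))" "[x]"] by (simp add: \<Theta>_def funpow_swap1)
  fix x assume x: "x \<in> X"
  {
    fix y z assume y: "y \<in> X" and z: "z \<in> X"
    have "real_of_int (phase_cochain B (T y) (T z) - phase_cochain B (T x) (T z) + phase_cochain B (T x) (T y))
      = real_of_int (phase_cochain B y z - phase_cochain B x z + phase_cochain B x y)"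
      using x y z by (subst (1 2) phase_cochain_cobd) (simp_all add: nz T_X equiv)
    then show "phase_cochain B (T y) (T z) - phase_cochain B (T x) (T z) + phase_cochain B (T x) (T y)
      = phase_cochain B y z - phase_cochain B x z + phase_cochain B x y"
      by (simp only: of_int_eq_iff)
  }
  {
    fix y assume y: "y \<in> X"
    have "real_of_int (\<Sum>g<k. phase_cochain B ((T ^^ g) x) ((T ^^ g) y))
        = (\<Sum>g<k. (Arg (B ((T ^^ g) y)) - Arg (B ((T ^^ g) x)) - Arg (B y / B x)) / (2 * pi))"
      using x y by (simp add: phase_cochain_real nz Tg_X) (simp add: Tg)
    also have "\<dots> = (\<Theta> y - \<Theta> x - k * Arg (B y / B x)) / (2 * pi)"
      by (simp add: \<Theta>_def sum_subtractf sum_divide_distrib[symmetric])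
    also have "\<dots> = real_of_int (S y - S x + k * phase_cochain B x y)"
      using x y by (simp add: S phase_cochain_real nz) (simp add: field_simps)
    finally have "(\<Sum>g<k. phase_cochain B ((T ^^ g) x) ((T ^^ g) y)) = S y - S x + k * phase_cochain B x y"
      by (simp only: of_int_eq_iff)
    then show "[(\<Sum>g<k. phase_cochain B ((T ^^ g) x) ((T ^^ g) y)) = S y - S x] (mod int k)"
      by (simp add: cong_def)
  }
  \<comment> \<open>Since \<Theta> is invariant, only \<open>- k * Arg (B x)\<close> changes, and
    \<open>Arg\<close> grows by \<open>2 * pi / k\<close> up to the multiple \<open>m 1 x\<close> of
    \<open>2 * pi\<close>.\<close>
  have "real_of_int (S (T x) - S x) = real_of_int (- 1 - k * m 1 x)"
    using x k2 by (simp add: S T_X \<Theta> m) (simp add: field_simps)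
  then have "S (T x) - S x = - 1 - k * m 1 x"
    by (simp only: of_int_eq_iff)
  then show "[S (T x) - S x = - 1] (mod int k)"
    by (simp add: cong_iff_dvd_diff)
qed

end

section \<open>Characters\<close>

definition character :: "('a::cstar_algebra_1 \<Rightarrow> complex) \<Rightarrow> bool" where
  "character x \<longleftrightarrow> (\<forall>a b. x (a + b) = x a + x b) \<and> (\<forall>c a. x (scaleC c a) = c * x a) \<and>
     (\<forall>a b. x (a * b) = x a * x b) \<and> x 1 = 1"

lemma character_add: "character x \<Longrightarrow> x (a + b) = x a + x b"
  and character_scaleC: "character x \<Longrightarrow> x (scaleC c a) = c * x a"
  and character_mult: "character x \<Longrightarrow> x (a * b) = x a * x b"
  and character_one: "character x \<Longrightarrow> x 1 = 1"
  by (simp_all add: character_def)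

lemma character_diff: "character x \<Longrightarrow> x (a - b) = x a - x b"
  using character_add[of x "a - b" b] by simp

lemma character_sum: "character x \<Longrightarrow> x (\<Sum>i\<in>I. a i) = (\<Sum>i\<in>I. x (a i))"
  using character_diff[of x 0 0]
  by (induction I rule: infinite_finite_induct) (auto simp: character_add)

lemma character_comp:
  "character x \<Longrightarrow> unital_star_hom \<psi> \<Longrightarrow> character (\<lambda>a. x (\<psi> a))"
  by (simp add: character_def unital_star_hom_def)

text \<open>If the bound failed, \<open>u = a / x a\<close> would have norm below 1, so
  \<open>1 - u\<close> would be inverted by the Neumann series although \<open>x\<close> sends it to
  0.\<close>

lemma character_bound:
  assumes "character x"
  shows "cmod (x a) \<le> norm a"
proof (rule ccontr)
  assume "\<not> ?thesis"
  then have less: "norm a < cmod (x a)" by simp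
  then have nz: "x a \<noteq> 0" by auto
  define u where "u = scaleC (1 / x a) a"
  have "norm u < 1"
    using less nz by (simp add: u_def norm_scaleC norm_divide divide_simps)
  then have sm: "summable (\<lambda>n. u ^ n)"
    by (rule complete_algebra_summable_geometric)
  have "u * (\<Sum>n. u ^ n) = (\<Sum>n. u ^ n) - 1"
    using suminf_split_head[OF sm] suminf_mult[OF sm, of u] by simp
  then have "x u * x (\<Sum>n. u ^ n) = x (\<Sum>n. u ^ n) - 1"
    using assms by (metis character_mult character_diff character_one)
  moreover have "x u = 1"
    using nz by (simp add: u_def character_scaleC[OF assms])
  ultimately show False by simp
qed

lemma scaleC_one_inject: "scaleC c (1::'a::cstar_algebra_1) = scaleC d 1 \<longleftrightarrow> c = d"
proof
  assume "scaleC c (1::'a) = scaleC d 1"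
  then have "scaleC (c - d) (1::'a) = 0"
    using scaleC_add_left[of "c - d" d "1::'a"] by simp
  then show "c = d"
    using norm_scaleC[of "c - d" "1::'a"] by simp
qed simp

lemma scalar_hom_character:
  assumes "unital_star_hom \<psi>" "\<And>a. \<psi> a = scaleC (x a) 1"
  shows "character x"
  unfolding character_def
proof (intro conjI allI)
  have hom: "\<psi> (a + b) = \<psi> a + \<psi> b" "\<psi> (scaleC c a) = scaleC c (\<psi> a)" "\<psi> (a * b) = \<psi> a * \<psi> b" "\<psi> 1 = 1"
    for a b c using assms(1) by (simp_all add: unital_star_hom_def)
  note inj = scaleC_one_inject[where 'a = 'a, symmetric]
  show "x (a + b) = x a + x b" for a b
    unfolding inj scaleC_add_left assms(2)[symmetric] by (rule hom)
  show "x (scaleC c a) = c * x a" for a c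
    unfolding inj scaleC_scaleC[symmetric] assms(2)[symmetric] by (rule hom)
  have "scaleC (x a) 1 * scaleC (x b) 1 = scaleC (x a * x b) (1::'a)" for a b
    by (simp add: scaleC_mult_left scaleC_scaleC)
  then show "x (a * b) = x a * x b" for a b
    unfolding inj using hom(3)[of a b] assms(2) by simp
  have "scaleC 1 (1::'a) = 1"
    using scaleC_of_real[of 1 "1::'a"] by simp
  then show "x 1 = 1"
    unfolding inj using hom(4) assms(2)[of 1] by simp
qed

lemma finite_uniformly_continuous:
  fixes \<phi> :: "real \<Rightarrow> 'a \<Rightarrow> 'b::real_normed_vector"
  assumes "finite F" "\<And>b. b \<in> F \<Longrightarrow> continuous_on {0..1} (\<lambda>t. \<phi> t b)" "\<epsilon> > 0"
  obtains n where "n > 0" "\<And>b s t. b \<in> F \<Longrightarrow> s \<in> {0..1} \<Longrightarrow> t \<in> {0..1} \<Longrightarrow> \<bar>s - t\<bar> \<le> 1 / real n \<Longrightarrow>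
      norm (\<phi> s b - \<phi> t b) < \<epsilon>"
proof -
  have "\<exists>d>0. \<forall>b\<in>F. \<forall>s\<in>{0..1}. \<forall>t\<in>{0..1}. \<bar>s - t\<bar> < d \<longrightarrow> norm (\<phi> s b - \<phi> t b) < \<epsilon>"
    using assms(1,2)
  proof (induction F)
    case (insert b F)
    then obtain d where d: "d > 0" "\<forall>b\<in>F. \<forall>s\<in>{0..1}. \<forall>t\<in>{0..1}. \<bar>s - t\<bar> < d \<longrightarrow> norm (\<phi> s b - \<phi> t b) < \<epsilon>"
      by auto
    have "uniformly_continuous_on {0..1} (\<lambda>t. \<phi> t b)"
      using insert.prems by (intro compact_uniformly_continuous) auto
    then obtain d' where d': "d' > 0" "\<forall>s\<in>{0..1}. \<forall>t\<in>{0..1}. \<bar>s - t\<bar> < d' \<longrightarrow> norm (\<phi> s b - \<phi> t b) < \<epsilon>"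
      unfolding uniformly_continuous_on_def dist_norm using \<open>\<epsilon> > 0\<close>
      by (metis abs_minus_commute real_norm_def)
    show ?case
      using d d' by (intro exI[of _ "min d d'"]) auto
  qed (auto intro: exI[of _ 1])
  then obtain d where d: "d > 0"
    "\<forall>b\<in>F. \<forall>s\<in>{0..1}. \<forall>t\<in>{0..1}. \<bar>s - t\<bar> < d \<longrightarrow> norm (\<phi> s b - \<phi> t b) < \<epsilon>"
    by blast
  then obtain n where "n > 0" "1 / real n < d"
    using real_arch_inverse[of d] by (auto simp: inverse_eq_divide)
  then show thesis
    using d by (intro that[of n]) auto
qed

section \<open>From a path of homomorphisms to a cyclic contraction of the character space, and the
  contradiction\<close>

theorem mainTheorem1:
  fixes k :: nat
    and \<alpha> :: "'a::cstar_algebra_1 \<Rightarrow> 'a"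
    and \<phi>1 :: "'a \<Rightarrow> 'a"
  assumes "k \<ge> 2"
    and "free_zk_action k \<alpha>"
    and "unital_star_hom \<phi>1"
    and "\<forall>g<k. \<phi>1 \<circ> (\<alpha> ^^ g) = (\<alpha> ^^ g) \<circ> \<phi>1"
  shows "\<not> (\<exists>\<phi> :: real \<Rightarrow> 'a \<Rightarrow> 'a.
             (\<forall>t\<in>{0..1}. unital_star_hom (\<phi> t)) \<and>
             (\<forall>a. continuous_on {0..1} (\<lambda>t. \<phi> t a)) \<and>
             \<phi> 1 = \<phi>1 \<and>
             (\<forall>a. \<exists>c. \<phi> 0 a = scaleC c 1))"
proof
  assume "\<exists>\<phi> :: real \<Rightarrow> 'a \<Rightarrow> 'a.
             (\<forall>t\<in>{0..1}. unital_star_hom (\<phi> t)) \<and>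
             (\<forall>a. continuous_on {0..1} (\<lambda>t. \<phi> t a)) \<and>
             \<phi> 1 = \<phi>1 \<and>
             (\<forall>a. \<exists>c. \<phi> 0 a = scaleC c 1)"
  then obtain \<phi> :: "real \<Rightarrow> 'a \<Rightarrow> 'a" where hom: "\<And>t. t \<in> {0..1} \<Longrightarrow> unital_star_hom (\<phi> t)"
    and cont: "\<And>a. continuous_on {0..1} (\<lambda>t. \<phi> t a)"
    and \<phi>_1: "\<phi> 1 = \<phi>1" and "\<forall>a. \<exists>c. \<phi> 0 a = scaleC c 1"
    by blast
  then obtain x0 where x0: "\<And>a. \<phi> 0 a = scaleC (x0 a) 1"
    by metis
  define T where "T x = (\<lambda>a. x (\<alpha> a))" for x :: "'a \<Rightarrow> complex"
  define f where "f x = (\<lambda>a. x (\<phi>1 a))" for x :: "'a \<Rightarrow> complex"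
  \<comment> \<open>With \<open>F\<close> finite and \<epsilon> positive, these are the basic
    entourages of the uniformity of pointwise convergence.\<close>
  define near where "near F \<epsilon> x y \<longleftrightarrow> (\<forall>b\<in>F. cmod (x b - y b) < \<epsilon>)"
    for F \<epsilon> and x y :: "'a \<Rightarrow> complex"
  have \<alpha>: "unital_star_hom \<alpha>" "\<alpha> ^^ k = id"
    using assms(2) by (auto simp: free_zk_action_def zk_action_def)
  have Tg: "(T ^^ g) x = (\<lambda>a. x ((\<alpha> ^^ g) a))" for g x
    by (induction g) (simp_all add: T_def funpow_swap1)
  have Tg_char: "character ((T ^^ g) x)" if "character x" for g x
    using that by (induction g) (auto simp: T_def character_comp[OF _ \<alpha>(1)])
  interpret cyclic_contraction k "{x. character x}" T f x0 "{near F \<epsilon> | F \<epsilon>. finite F \<and> \<epsilon> > 0}"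
  proof
    show "k \<ge> 2" by fact
    show "T x \<in> {x. character x}" "f x \<in> {x. character x}" if "x \<in> {x. character x}" for x
      using that \<alpha>(1) assms(3) by (simp_all add: T_def f_def character_comp)
    show "x0 \<in> {x. character x}"
      using scalar_hom_character[OF hom x0] by simp
    show "(T ^^ k) x = x" for x
      by (simp add: Tg \<alpha>(2))
    have "\<phi>1 (\<alpha> a) = \<alpha> (\<phi>1 a)" for a
      using assms(4)[rule_format, of 1] \<open>k \<ge> 2\<close> by (simp add: fun_eq_iff)
    then show "f (T x) = T (f x)" for x
      by (simp add: f_def T_def)
    show "R x0 x0" if "R \<in> {near F \<epsilon> | F \<epsilon>. finite F \<and> \<epsilon> > 0}" for R
      using that by (auto simp: near_def)
  next
    fix R assume "R \<in> {near F \<epsilon> | F \<epsilon>. finite F \<and> \<epsilon> > 0}"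
    then obtain F \<epsilon> where R: "R = near F \<epsilon>" and F: "finite F" and \<epsilon>: "\<epsilon> > 0"
      by blast
    obtain n where n: "n > 0" and unif: "\<And>b s t. b \<in> F \<Longrightarrow> s \<in> {0..1} \<Longrightarrow> t \<in> {0..1} \<Longrightarrow>
        \<bar>s - t\<bar> \<le> 1 / real n \<Longrightarrow> norm (\<phi> s b - \<phi> t b) < \<epsilon> / 2"
      by (rule finite_uniformly_continuous[of F \<phi> "\<epsilon> / 2", OF F cont])
        (use \<epsilon> in simp, blast)
    define H where "H i x = (\<lambda>a. x (\<phi> (real i / real n) a))" for i and x :: "'a \<Rightarrow> complex"
    \<comment> \<open>All elements at which the sampled homotopy on translates by
      \<open>T ^^ g\<close> evaluates a character when tested on \<open>F\<close>; there are
      finitely many.\<close>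
    define F' where "F' = (\<lambda>(g, i, b). (\<alpha> ^^ g) (\<phi> (real i / real n) b)) ` ({..<k} \<times> {..n} \<times> F)"
    have unit: "real i / real n \<in> {0..1}" if "i \<le> n" for i
      using that n by (simp add: divide_simps)
    have H_char: "character (H i x)" if "i \<le> n" "character x" for i x
      unfolding H_def by (rule character_comp[OF that(2) hom[OF unit[OF that(1)]]])
    \<comment> \<open>First \<open>x\<close> is exchanged for \<open>y\<close> at a fixed time, then
      the time moves by at most one step, where \<open>character_bound\<close> transfers norm
      continuity. Each move costs \<open>\<epsilon> / 2\<close>.\<close>
    have close: "near F \<epsilon> (H i ((T ^^ g) x)) (H j ((T ^^ g) y))"
      if "character x" "character y" "near F' (\<epsilon> / 2) x y" "g < k" "i \<le> n" "j \<le> n"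
        and ij: "\<bar>real i - real j\<bar> \<le> 1" for x y g i j
      unfolding near_def
    proof
      fix b assume b: "b \<in> F"
      define s t where "s = real i / real n" and "t = real j / real n"
      have "(\<alpha> ^^ g) (\<phi> s b) \<in> F'"
        unfolding F'_def s_def using that b by (intro image_eqI[of _ _ "(g, i, b)"]) auto
      then have 1: "cmod ((T ^^ g) x (\<phi> s b) - (T ^^ g) y (\<phi> s b)) < \<epsilon> / 2"
        using that(3) by (simp add: near_def Tg)
      have "\<bar>s - t\<bar> \<le> 1 / real n"
        using ij n by (simp add: s_def t_def diff_divide_distrib[symmetric] abs_divide divide_right_mono)
      then have "norm (\<phi> s b - \<phi> t b) < \<epsilon> / 2"
        using unif[OF b, of s t] unit that by (simp add: s_def t_def)
      then have "cmod ((T ^^ g) y (\<phi> s b - \<phi> t b)) < \<epsilon> / 2"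
        using character_bound[OF Tg_char[OF that(2)]] by (meson le_less_trans)
      then have 2: "cmod ((T ^^ g) y (\<phi> s b) - (T ^^ g) y (\<phi> t b)) < \<epsilon> / 2"
        by (simp only: character_diff[OF Tg_char[OF that(2)]])
      show "cmod (H i ((T ^^ g) x) b - H j ((T ^^ g) y) b) < \<epsilon>"
        using norm_diff_triangle_less[OF 1 2] by (simp add: H_def s_def t_def)
    qed
    show "\<exists>R'\<in>{near F \<epsilon> | F \<epsilon>. finite F \<and> \<epsilon> > 0}. \<exists>n H.
        (\<forall>x\<in>{x. character x}. H 0 x = x0 \<and> H n x = f x) \<and>
        (\<forall>i\<le>n. \<forall>x\<in>{x. character x}. H i x \<in> {x. character x}) \<and>
        (\<forall>x\<in>{x. character x}. \<forall>y\<in>{x. character x}. R' x y \<longrightarrow>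
          (\<forall>g<k. \<forall>i<n. \<forall>a\<in>{H i, H (Suc i)}. \<forall>b\<in>{H i, H (Suc i)}.
           R (a ((T ^^ g) x)) (b ((T ^^ g) y))))"
    proof (intro bexI[of _ "near F' (\<epsilon> / 2)"] exI[of _ n] exI[of _ H] conjI ballI allI impI)
      show "near F' (\<epsilon> / 2) \<in> {near F \<epsilon> | F \<epsilon>. finite F \<and> \<epsilon> > 0}"
        using F \<epsilon> by (auto simp: F'_def intro!: exI[of _ F'] exI[of _ "\<epsilon> / 2"])
      show "H 0 x = x0" if "x \<in> {x. character x}" for x
        using that by (simp add: H_def x0 character_scaleC character_one)
      show "H n x = f x" for x
        using n by (simp add: H_def f_def \<phi>_1)
      show "H i x \<in> {x. character x}" if "i \<le> n" "x \<in> {x. character x}" for i x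
        using that H_char by simp
      show "R (a ((T ^^ g) x)) (b ((T ^^ g) y))"
        if "x \<in> {x. character x}" "y \<in> {x. character x}" "near F' (\<epsilon> / 2) x y" "g < k" "i < n"
          "a \<in> {H i, H (Suc i)}" "b \<in> {H i, H (Suc i)}" for x y g i a b
        using that unfolding R by (auto intro!: close)
    qed
  qed
  define \<omega> where "\<omega> = cis (2 * pi / k)"
  have \<omega>: "cmod \<omega> = 1" "cnj \<omega> * \<omega> = 1"
    by (simp_all add: \<omega>_def cis_cnj cis_mult)
  \<comment> \<open>Freeness is applied to the single function
    \<open>g \<mapsto> \<omega> ^ g\<close>, with error 1/2.\<close>
  have "\<exists>(n::nat) a b. \<forall>g<k. norm (scaleC (\<omega> ^ g) 1 - (\<Sum>i<n. a i * (\<alpha> ^^ g) (b i))) < 1 / 2"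
    using assms(2)[unfolded free_zk_action_def, THEN conjunct2, rule_format,
        of "1 / 2" "\<lambda>g. scaleC (\<omega> ^ g) 1"] by simp
  then obtain n :: nat and a b
    where ab: "\<And>g. g < k \<Longrightarrow> norm (scaleC (\<omega> ^ g) 1 - (\<Sum>i<n. a i * (\<alpha> ^^ g) (b i))) < 1 / 2"
    by blast
  \<comment> \<open>The value at \<open>x\<close> of the projection of \<open>b i\<close> onto the
    \<omega>-eigenspace of \<alpha>.\<close>
  define \<beta> where "\<beta> i x = (\<Sum>g<k. cnj \<omega> ^ g * x ((\<alpha> ^^ g) (b i))) / k" for i :: nat and x
  define F where "F = (\<lambda>(g, i). (\<alpha> ^^ g) (b i)) ` ({..<k} \<times> {..<n})"
  have k: "real k > 0" using assms(1) by simp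
  have \<beta>_T: "\<beta> i (T x) = \<omega> * \<beta> i x" for i x
  proof -
    have "\<omega> ^ k = 1"
      using k by (simp add: \<omega>_def Complex.DeMoivre)
    then have cnj_k: "cnj \<omega> ^ k = 1"
      by (metis complex_cnj_power complex_cnj_one)
    have "\<beta> i (T x) = (\<Sum>g<k. \<omega> * (cnj \<omega> ^ Suc g * x ((\<alpha> ^^ Suc g) (b i)))) / k"
      unfolding \<beta>_def T_def using \<omega>(2)
      by (intro arg_cong2[where f = "(/)"] sum.cong refl) (simp add: mult.assoc[symmetric] mult.commute[of \<omega>])
    also have "\<dots> = \<omega> * (\<Sum>g<k. cnj \<omega> ^ Suc g * x ((\<alpha> ^^ Suc g) (b i))) / k"
      by (simp only: sum_distrib_left)
    also have "(\<Sum>g<k. cnj \<omega> ^ Suc g * x ((\<alpha> ^^ Suc g) (b i))) = (\<Sum>g<k. cnj \<omega> ^ g * x ((\<alpha> ^^ g) (b i)))"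
    proof -
      have "(\<Sum>g<Suc k. cnj \<omega> ^ g * x ((\<alpha> ^^ g) (b i)))
          = x (b i) + (\<Sum>g<k. cnj \<omega> ^ Suc g * x ((\<alpha> ^^ Suc g) (b i)))"
        by (subst sum.lessThan_Suc_shift) simp
      moreover have "(\<Sum>g<Suc k. cnj \<omega> ^ g * x ((\<alpha> ^^ g) (b i)))
          = (\<Sum>g<k. cnj \<omega> ^ g * x ((\<alpha> ^^ g) (b i))) + x (b i)"
        by (simp add: cnj_k \<alpha>(2))
      ultimately show ?thesis by (simp del: sum.lessThan_Suc)
    qed
    finally show ?thesis by (simp add: \<beta>_def)
  qed
  have \<beta>_near: "cmod (\<beta> i x - \<beta> i y) < \<epsilon>" if "near F \<epsilon> x y" "i < n" for i x y \<epsilon>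
  proof -
    have "cmod (\<Sum>g<k. cnj \<omega> ^ g * (x ((\<alpha> ^^ g) (b i)) - y ((\<alpha> ^^ g) (b i)))) < (\<Sum>g<k. \<epsilon>)"
    proof (rule le_less_trans[OF norm_sum sum_strict_mono])
      fix g assume "g \<in> {..<k}"
      then have "(\<alpha> ^^ g) (b i) \<in> F"
        unfolding F_def using that by (intro image_eqI[of _ _ "(g, i)"]) auto
      then show "cmod (cnj \<omega> ^ g * (x ((\<alpha> ^^ g) (b i)) - y ((\<alpha> ^^ g) (b i)))) < \<epsilon>"
        using that \<omega>(1) by (simp add: near_def norm_mult norm_power)
    qed (use k in auto)
    then show ?thesis
      using k by (simp add: \<beta>_def diff_divide_distrib[symmetric] sum_subtractf[symmetric]
          right_diff_distrib[symmetric] norm_divide divide_simps mult.commute)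
  qed
  \<comment> \<open>Chosen so that all \<beta> below \<delta> would force the sum of
    \<open>x (a i) * \<beta> i x\<close> below 1/2; the summand 1 keeps the denominator positive and
    the estimate strict.\<close>
  define \<delta> where "\<delta> = 1 / (2 * (1 + (\<Sum>i<n. norm (a i))))"
  have pos: "1 + (\<Sum>i<n. norm (a i)) > 0"
    by (intro add_pos_nonneg sum_nonneg) auto
  then have \<delta>: "\<delta> > 0" by (simp add: \<delta>_def)
  \<comment> \<open>Averaging the approximation against \<open>cnj \<omega> ^ g\<close> puts the sum
    of \<open>x (a i) * \<beta> i x\<close> within 1/2 of 1, so not every \<beta> can be small at
    \<open>x\<close>.\<close>
  have \<beta>_large: "\<exists>i<n. cmod (\<beta> i x) \<ge> \<delta>" if x: "character x" for x
  proof (rule ccontr)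
    assume "\<not> ?thesis"
    then have small: "cmod (\<beta> i x) < \<delta>" if "i < n" for i
      using that by (auto simp: not_le)
    have "(\<Sum>i<n. x (a i) * \<beta> i x) = (\<Sum>i<n. \<Sum>g<k. cnj \<omega> ^ g * (x (a i) * x ((\<alpha> ^^ g) (b i)))) / k"
      by (simp add: \<beta>_def sum_distrib_left sum_divide_distrib mult_ac)
    also have "(\<Sum>i<n. \<Sum>g<k. cnj \<omega> ^ g * (x (a i) * x ((\<alpha> ^^ g) (b i))))
        = (\<Sum>g<k. cnj \<omega> ^ g * x (\<Sum>i<n. a i * (\<alpha> ^^ g) (b i)))"
      by (subst sum.swap) (simp add: character_sum[OF x] character_mult[OF x] sum_distrib_left)
    finally have "1 - (\<Sum>i<n. x (a i) * \<beta> i x)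
        = (\<Sum>g<k. 1 - cnj \<omega> ^ g * x (\<Sum>i<n. a i * (\<alpha> ^^ g) (b i))) / k"
      using k by (simp add: sum_subtractf diff_divide_distrib)
    also have "(\<Sum>g<k. 1 - cnj \<omega> ^ g * x (\<Sum>i<n. a i * (\<alpha> ^^ g) (b i)))
        = (\<Sum>g<k. cnj \<omega> ^ g * x (scaleC (\<omega> ^ g) 1 - (\<Sum>i<n. a i * (\<alpha> ^^ g) (b i))))"
      by (simp add: character_diff[OF x] character_scaleC[OF x] character_one[OF x]
          right_diff_distrib power_mult_distrib[symmetric] \<omega>(2))
    finally have eq: "1 - (\<Sum>i<n. x (a i) * \<beta> i x)
        = (\<Sum>g<k. cnj \<omega> ^ g * x (scaleC (\<omega> ^ g) 1 - (\<Sum>i<n. a i * (\<alpha> ^^ g) (b i)))) / k" .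
    have "cmod (\<Sum>g<k. cnj \<omega> ^ g * x (scaleC (\<omega> ^ g) 1 - (\<Sum>i<n. a i * (\<alpha> ^^ g) (b i)))) \<le> (\<Sum>g<k. 1 / 2)"
    proof (rule sum_norm_le)
      fix g assume "g \<in> {..<k}"
      then have "norm (scaleC (\<omega> ^ g) 1 - (\<Sum>i<n. a i * (\<alpha> ^^ g) (b i))) < 1 / 2"
        using ab by simp
      then show "cmod (cnj \<omega> ^ g * x (scaleC (\<omega> ^ g) 1 - (\<Sum>i<n. a i * (\<alpha> ^^ g) (b i)))) \<le> 1 / 2"
        using character_bound[OF x, of "scaleC (\<omega> ^ g) 1 - (\<Sum>i<n. a i * (\<alpha> ^^ g) (b i))"] \<omega>(1)
        by (simp add: norm_mult norm_power)
    qed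
    then have half: "cmod (1 - (\<Sum>i<n. x (a i) * \<beta> i x)) \<le> 1 / 2"
      unfolding eq using k by (simp add: norm_divide divide_simps)
    have "cmod (\<Sum>i<n. x (a i) * \<beta> i x) \<le> (\<Sum>i<n. norm (a i) * \<delta>)"
      using less_imp_le[OF small] character_bound[OF x]
      by (intro sum_norm_le) (auto simp: norm_mult intro!: mult_mono)
    also have "\<dots> < (1 + (\<Sum>i<n. norm (a i))) * \<delta>"
      using \<delta> by (simp add: sum_distrib_right distrib_right)
    also have "\<dots> = 1 / 2"
      using pos by (simp add: \<delta>_def)
    finally show False
      using half norm_triangle_ineq[of "1 - (\<Sum>i<n. x (a i) * \<beta> i x)" "\<Sum>i<n. x (a i) * \<beta> i x"] by simp
  qed
  \<comment> \<open>Zeros of \<open>\<beta> i\<close> are filled with the first eigenfunction that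
    is nonzero there. That index is constant along orbits, so \<open>B i\<close> is nowhere zero on
    characters and still equivariant.\<close>
  define B where "B i x = (if \<beta> i x = 0 then \<beta> (LEAST j. \<beta> j x \<noteq> 0) x else \<beta> i x)" for i x
  have "\<omega> \<noteq> 0" using \<omega>(1) by auto
  have "chern_cochain (phase_cochain (B i))" for i
  proof (rule chern_cochain_phase)
    fix x :: "'a \<Rightarrow> complex" assume "x \<in> {x. character x}"
    then obtain j where "\<beta> j x \<noteq> 0"
      using \<beta>_large[of x] \<delta> by force
    then show "B i x \<noteq> 0"
      using LeastI[of "\<lambda>j. \<beta> j x \<noteq> 0" j] by (simp add: B_def)
    show "B i (T x) = cis (2 * pi / k) * B i x"
      using \<open>\<omega> \<noteq> 0\<close> by (simp add: B_def \<beta>_T \<omega>_def)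
  qed
  then have "\<exists>l\<in>small_lists {x. character x} (near F (\<delta> / 2)).
      chern_prod (map (\<lambda>i. phase_cochain (B i)) [0..<n]) l \<noteq> 0"
    using \<delta> by (intro chern_prod_nonvanishing) (auto simp: F_def intro!: exI[of _ F] exI[of _ "\<delta> / 2"])
  then obtain l where l: "\<And>x. x \<in> set l \<Longrightarrow> character x"
      "\<And>x y. x \<in> set l \<Longrightarrow> y \<in> set l \<Longrightarrow> near F (\<delta> / 2) x y"
    and nonzero: "chern_prod (map (\<lambda>i. phase_cochain (B i)) [0..<n]) l \<noteq> 0"
    by (auto simp: small_lists_def)
  have "l \<noteq> []"
  proof
    assume "l = []"
    then show False
      using nonzero by (cases "map (\<lambda>i. phase_cochain (B i)) [0..<n]") simp_all
  qed
  then obtain x where x: "x \<in> set l" by (cases l) auto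
  obtain i where i: "i < n" "cmod (\<beta> i x) \<ge> \<delta>"
    using \<beta>_large[OF l(1)[OF x]] by blast
  \<comment> \<open>One vertex with \<open>\<beta> i\<close> at least \<delta> suffices: smallness
    of \<open>l\<close> keeps \<open>\<beta> i\<close> above \<open>\<delta> / 2\<close> at every
    vertex, so \<open>B i\<close> agrees with \<open>\<beta> i\<close> on \<open>l\<close> and its
    cocycle vanishes there.\<close>
  have large: "cmod (\<beta> i y) > \<delta> / 2" if "y \<in> set l" for y
    using \<beta>_near[OF l(2)[OF x that] i(1)] i(2) norm_triangle_ineq2[of "\<beta> i x" "\<beta> i y"] by linarith
  have B: "B i y = \<beta> i y" "B i y \<noteq> 0" if "y \<in> set l" for y
    using large[OF that] \<delta> by (auto simp: B_def)
  have "cmod (B i z - B i y) < cmod (B i y)" if "y \<in> set l" "z \<in> set l" for y z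
    using \<beta>_near[OF l(2)[OF that(2,1)] i(1)] large[OF that(1)] B that by simp
  then have "phase_cochain (B i) y z - phase_cochain (B i) x z + phase_cochain (B i) x y = 0"
    if "x \<in> set l" "y \<in> set l" "z \<in> set l" for x y z
    using that B by (intro phase_cochain_cobd_eq_0) auto
  then have "chern_prod (map (\<lambda>i. phase_cochain (B i)) [0..<n]) l = 0"
    using i(1) by (intro chern_prod_eq_0[of "phase_cochain (B i)"]) auto
  with nonzero show False by contradiction
qed

end
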